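(* Let $n\in\mathbb{N}$ with $n\ge 1$, let $M,N\in\mathbb{R}^{n\times n}$, and let $M=M_V+M_0+(\operatorname{wt}M)\,\mathcal{E}_n$ and $N=N_V+N_0+(\operatorname{wt}N)\,\mathcal{E}_n$ be their canonical decompositions, with $N_V=a1_n^T+1_nb^T$, where $a,b\in\mathbb{R}^n$ and $1_n^Ta=1_n^Tb=0$. (i) If $M=N^TN$, then $$\operatorname{wt}M=|a|^2+n\,(\operatorname{wt}N)^2,$$ $M_V=y1_n^T+1_ny^T$ with $y=N_0^Ta+n\,(\operatorname{wt}N)\,b$, and $M_0=N_0^TN_0+n\,bb^T$. (ii) If $M=N^2$, then $$\operatorname{wt}M=b^Ta+n\,(\operatorname{wt}N)^2,$$ $M_V=y1_n^T+1_nz^T$ with $y=N_0a+n\,(\operatorname{wt}N)\,a$ and $z=N_0^Tb+n\,(\operatorname{wt}N)\,b$, and $M_0=N_0^2+n\,ab^T$.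
   Context: Notation: $1_n\in\mathbb{R}^n$ is the column vector with all entries equal to $1$; $\mathcal{E}_n = 1_n1_n^T$; $|a|$ is the Euclidean norm. For $M=(m_{i,j})\in\mathbb{R}^{n\times n}$, $\operatorname{wt} M = \frac{1}{n^2}\sum_{i,j=1}^n m_{i,j}$. Let $V_n$ be the space of matrices $M\in\mathbb{R}^{n\times n}$ such that $m_{i,j}+m_{k,l}=m_{i,l}+m_{k,j}$ for all $i,j,k,l\in\{1,\dots,n\}$ and $\sum_{i,j=1}^n m_{i,j}=0$. Every $M\in\mathbb{R}^{n\times n}$ has a unique (canonical) decomposition $M=M_V+M_0+(\operatorname{wt}M)\,\mathcal{E}_n$ in which $M_V\in V_n$ and $M_0\in\mathbb{R}^{n\times n}$ has all row sums and all column sums equal to $0$. The matrix $M_V$ can be written uniquely as $M_V=a1_n^T+1_nb^T$ with $a,b\in\mathbb{R}^n$, $1_n^Ta=1_n^Tb=0$. *)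

theory Defs
  imports "HOL-Analysis.Analysis"
begin

text \<open>Throughout, n is \<open>CARD('n)\<close>, and \<open>1 :: real^'n\<close> is the all-ones vector.  A product
  of matrices is always \<open>**\<close>: on \<open>real^'n^'n\<close>, \<open>*\<close> and \<open>^\<close> act entrywise.\<close>

definition outer :: "real^'n \<Rightarrow> real^'n \<Rightarrow> real^'n^'n" where
  "outer u v = (columnvector u :: real^1^'n) ** (rowvector v :: real^'n^1)"

definition all_ones :: "real^'n^'n" where
  "all_ones = outer 1 1"

definition wt :: "real^'n^'n \<Rightarrow> real" where
  "wt M = (\<Sum>i\<in>UNIV. \<Sum>j\<in>UNIV. M $ i $ j) / (real CARD('n))\<^sup>2"

definition V_space :: "(real^'n^'n) set" where
  "V_space = {M. (\<forall>i j k l. M $ i $ j + M $ k $ l = M $ i $ l + M $ k $ j)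
                 \<and> (\<Sum>i\<in>UNIV. \<Sum>j\<in>UNIV. M $ i $ j) = 0}"

definition zero_line_sums :: "(real^'n^'n) set" where
  "zero_line_sums = {M. (\<forall>i. (\<Sum>j\<in>UNIV. M $ i $ j) = 0) \<and> (\<forall>j. (\<Sum>i\<in>UNIV. M $ i $ j) = 0)}"

text \<open>A relation rather than a pair of functions of M; existence and uniqueness of the decomposition
  are proved below.\<close>

definition canonical_decomp :: "real^'n^'n \<Rightarrow> real^'n^'n \<Rightarrow> real^'n^'n \<Rightarrow> bool" where
  "canonical_decomp M MV M0 \<longleftrightarrow>
     MV \<in> V_space \<and> M0 \<in> zero_line_sums \<and> M = MV + M0 + wt M *\<^sub>R all_ones"

lemma outer_nth [simp]: "outer u v $ i $ j = u $ i * v $ j"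
  by (simp add: outer_def columnvector_def rowvector_def matrix_matrix_mult_def)

lemma all_ones_nth [simp]: "all_ones $ i $ j = 1"
  by (simp add: all_ones_def)

lemma V_space_nth:
  fixes A :: "real^'n^'n"
  assumes "A \<in> V_space"
  shows "A $ i $ j = ((\<Sum>l\<in>UNIV. A $ i $ l) + (\<Sum>k\<in>UNIV. A $ k $ j)) / real CARD('n)"
proof -
  have eq: "A $ i $ j + A $ k $ l = A $ i $ l + A $ k $ j" for k l
    using assms by (simp add: V_space_def)
  have s0: "(\<Sum>k\<in>UNIV. \<Sum>l\<in>UNIV. A $ k $ l) = 0"
    using assms by (simp add: V_space_def)
  have "(\<Sum>k\<in>(UNIV::'n set). \<Sum>l\<in>(UNIV::'n set). A $ i $ j + A $ k $ l)
      = (\<Sum>k\<in>(UNIV::'n set). \<Sum>l\<in>(UNIV::'n set). A $ i $ l + A $ k $ j)"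
    by (simp add: eq)
  then have "real CARD('n) * (real CARD('n) * A $ i $ j)
      = real CARD('n) * ((\<Sum>l\<in>UNIV. A $ i $ l) + (\<Sum>k\<in>UNIV. A $ k $ j))"
    by (simp add: sum.distrib s0 algebra_simps flip: sum_distrib_left)
  then have "real CARD('n) * A $ i $ j = (\<Sum>l\<in>UNIV. A $ i $ l) + (\<Sum>k\<in>UNIV. A $ k $ j)"
    by (subst (asm) mult_cancel_left) auto
  then show ?thesis
    by (simp add: field_simps)
qed

lemma canonical_decomp_row_sum:
  fixes M :: "real^'n^'n"
  assumes "canonical_decomp M A B"
  shows "(\<Sum>j\<in>UNIV. A $ i $ j) = (\<Sum>j\<in>UNIV. M $ i $ j) - real CARD('n) * wt M"
proof -
  have B: "(\<Sum>j\<in>UNIV. B $ i $ j) = 0" and M: "M = A + B + wt M *\<^sub>R all_ones"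
    using assms by (auto simp: canonical_decomp_def zero_line_sums_def)
  have "M $ i $ j = A $ i $ j + B $ i $ j + wt M" for j
    by (subst M) simp
  then show ?thesis
    by (simp add: sum.distrib B)
qed

lemma canonical_decomp_col_sum:
  fixes M :: "real^'n^'n"
  assumes "canonical_decomp M A B"
  shows "(\<Sum>i\<in>UNIV. A $ i $ j) = (\<Sum>i\<in>UNIV. M $ i $ j) - real CARD('n) * wt M"
proof -
  have B: "(\<Sum>i\<in>UNIV. B $ i $ j) = 0" and M: "M = A + B + wt M *\<^sub>R all_ones"
    using assms by (auto simp: canonical_decomp_def zero_line_sums_def)
  have "M $ i $ j = A $ i $ j + B $ i $ j + wt M" for i
    by (subst M) simp
  then show ?thesis
    by (simp add: sum.distrib B)
qed

lemma canonical_decomp_unique: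
  fixes M :: "real^'n^'n"
  assumes 1: "canonical_decomp M A B" and 2: "canonical_decomp M A' B'"
  shows "A = A' \<and> B = B'"
proof -
  have V: "A \<in> V_space" "A' \<in> V_space"
    using assms by (auto simp: canonical_decomp_def)
  have "A = A'"
    unfolding vec_eq_iff
  proof (intro allI)
    fix i j
    show "A $ i $ j = A' $ i $ j"
      unfolding V_space_nth[OF V(1), of i j] V_space_nth[OF V(2), of i j]
        canonical_decomp_row_sum[OF 1] canonical_decomp_row_sum[OF 2]
        canonical_decomp_col_sum[OF 1] canonical_decomp_col_sum[OF 2] ..
  qed
  moreover have "A + B + wt M *\<^sub>R all_ones = A' + B' + wt M *\<^sub>R all_ones"
    using assms unfolding canonical_decomp_def by metis
  ultimately show ?thesis
    by simp
qed

lemma canonical_decomp_exists: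
  fixes M :: "real^'n^'n"
  shows "\<exists>A B. canonical_decomp M A B"
proof -
  define n where "n = real CARD('n)"
  have n: "n > 0" by (simp add: n_def)
  define r where "r i = (\<Sum>j\<in>UNIV. M $ i $ j)" for i
  define c where "c j = (\<Sum>i\<in>UNIV. M $ i $ j)" for j
  define A :: "real^'n^'n" where "A = (\<chi> i j. (r i + c j) / n - 2 * wt M)"
  have sr: "(\<Sum>i\<in>UNIV. r i) = n\<^sup>2 * wt M"
    using n by (simp add: r_def wt_def n_def)
  have sc: "(\<Sum>j\<in>UNIV. c j) = n\<^sup>2 * wt M"
    using sr unfolding r_def c_def by (subst sum.swap) simp
  have rowA: "(\<Sum>j\<in>UNIV. A $ i $ j) = r i - n * wt M" for i
    using n by (simp add: A_def sum_subtractf sum.distrib sc flip: sum_divide_distrib n_def)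
      (simp add: field_simps power2_eq_square)
  have colA: "(\<Sum>i\<in>UNIV. A $ i $ j) = c j - n * wt M" for j
    using n by (simp add: A_def sum_subtractf sum.distrib sr flip: sum_divide_distrib n_def)
      (simp add: field_simps power2_eq_square)
  have "A \<in> V_space"
    unfolding V_space_def mem_Collect_eq rowA
    by (auto simp: sum_subtractf sr power2_eq_square simp flip: n_def)
      (simp add: A_def add_divide_distrib)
  moreover have "M - A - wt M *\<^sub>R all_ones \<in> zero_line_sums"
    by (simp add: zero_line_sums_def sum_subtractf rowA colA flip: n_def)
      (simp add: r_def c_def)
  ultimately have "canonical_decomp M A (M - A - wt M *\<^sub>R all_ones)"
    by (simp add: canonical_decomp_def)
  then show ?thesis by blast
qed

lemma V_space_outer_exists_unique:
  fixes A :: "real^'n^'n"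
  assumes A: "A \<in> V_space"
  shows "\<exists>!(a, b). A = outer a 1 + outer 1 b \<and> 1 \<bullet> a = 0 \<and> 1 \<bullet> b = 0"
proof -
  define n where "n = real CARD('n)"
  have n: "n > 0" by (simp add: n_def)
  define a :: "real^'n" where "a = (\<chi> i. (\<Sum>j\<in>UNIV. A $ i $ j) / n)"
  define b :: "real^'n" where "b = (\<chi> j. (\<Sum>i\<in>UNIV. A $ i $ j) / n)"
  have s0: "(\<Sum>i\<in>UNIV. \<Sum>j\<in>UNIV. A $ i $ j) = 0"
    using A by (simp add: V_space_def)
  have s0': "(\<Sum>j\<in>UNIV. \<Sum>i\<in>UNIV. A $ i $ j) = 0"
    using s0 by (subst sum.swap)
  show ?thesis
  proof (rule ex1I[of _ "(a, b)"])
    have "A = outer a 1 + outer 1 b"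
      unfolding vec_eq_iff
    proof (intro allI)
      fix i j
      show "A $ i $ j = (outer a 1 + outer 1 b) $ i $ j"
        by (subst V_space_nth[OF A]) (simp add: a_def b_def n_def add_divide_distrib)
    qed
    moreover have "1 \<bullet> a = 0" "1 \<bullet> b = 0"
      by (simp_all add: inner_vec_def a_def b_def s0 s0' flip: sum_divide_distrib)
    ultimately show "case (a, b) of (a, b) \<Rightarrow> A = outer a 1 + outer 1 b \<and> 1 \<bullet> a = 0 \<and> 1 \<bullet> b = 0"
      by simp
  next
    fix p :: "(real^'n) \<times> (real^'n)"
    assume "case p of (a, b) \<Rightarrow> A = outer a 1 + outer 1 b \<and> 1 \<bullet> a = 0 \<and> 1 \<bullet> b = 0"
    then obtain a' b' where p: "p = (a', b')" and eq: "A = outer a' 1 + outer 1 b'"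
      and z: "1 \<bullet> a' = 0" "1 \<bullet> b' = 0"
      by auto
    have z': "(\<Sum>i\<in>UNIV. a' $ i) = 0" "(\<Sum>i\<in>UNIV. b' $ i) = 0"
      using z by (simp_all add: inner_vec_def)
    have "a = a'" "b = b'"
      by (simp_all add: vec_eq_iff a_def b_def eq sum.distrib z' n_def)
    then show "p = (a, b)"
      using p by simp
  qed
qed

end

theory Submission
  imports Defs
begin

text \<open>In the expansion of
  \<open>(p 1\<^sup>T + 1 q\<^sup>T + P\<^sub>0 + s E) (u 1\<^sup>T + 1 v\<^sup>T + Q\<^sub>0 + t E)\<close>
  every term containing a product of \<open>1\<close> with a zero-sum vector or with \<open>P\<^sub>0\<close>, \<open>Q\<^sub>0\<close> vanishes,
  and \<open>1\<^sup>T 1 = n\<close>.  What remains is \<open>y 1\<^sup>T + 1 z\<^sup>T\<close>, plus \<open>P\<^sub>0 Q\<^sub>0 + n p v\<^sup>T\<close>,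
  plus a multiple of \<open>E\<close>, which is the canonical decomposition of the product by uniqueness.
  The two claims are the cases of the factors \<open>N\<^sup>T, N\<close> and \<open>N, N\<close>.\<close>

lemma one_inner_eq_sum: "(1 :: real^'n) \<bullet> x = (\<Sum>i\<in>UNIV. x $ i)"
  by (simp add: inner_vec_def)

lemma outer_sum_in_V_space:
  fixes y z :: "real^'n"
  assumes "1 \<bullet> y = 0" "1 \<bullet> z = 0"
  shows "outer y 1 + outer 1 z \<in> V_space"
  using assms by (simp add: V_space_def one_inner_eq_sum sum.distrib flip: sum_distrib_left)

text \<open>The entries of \<open>A\<close> and of \<open>B\<close> each sum to 0, so averaging
  leaves only \<open>c\<close>. Hence the coefficient of \<open>all_ones\<close> can be read off an
  expansion without computing \<open>wt M\<close> beforehand.\<close>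

lemma canonical_decompI:
  fixes M A B :: "real^'n^'n"
  assumes A: "A \<in> V_space" and B: "B \<in> zero_line_sums" and M: "M = A + B + c *\<^sub>R all_ones"
  shows "wt M = c" "canonical_decomp M A B"
proof -
  have "(\<Sum>i\<in>UNIV. \<Sum>j\<in>UNIV. A $ i $ j) = 0" "\<And>i. (\<Sum>j\<in>UNIV. B $ i $ j) = 0"
    using A B by (simp_all add: V_space_def zero_line_sums_def)
  then show wt: "wt M = c"
    by (simp add: M wt_def sum.distrib power2_eq_square)
  show "canonical_decomp M A B"
    using A B M unfolding canonical_decomp_def wt by blast
qed

lemma zero_line_sums_transpose:
  "B \<in> zero_line_sums \<Longrightarrow> transpose B \<in> zero_line_sums"
  by (simp add: zero_line_sums_def transpose_def)

text \<open>Row sums of the product combine the row sums of \<open>C\<close>; its column sums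
  combine the column sums of \<open>B\<close>.\<close>

lemma zero_line_sums_mult:
  assumes "B \<in> zero_line_sums" "C \<in> zero_line_sums"
  shows "B ** C \<in> zero_line_sums"
proof -
  have "(\<Sum>j\<in>UNIV. \<Sum>k\<in>UNIV. B $ i $ k * C $ k $ j) = 0" for i
    using assms by (subst sum.swap) (simp add: zero_line_sums_def flip: sum_distrib_left)
  moreover have "(\<Sum>i\<in>UNIV. \<Sum>k\<in>UNIV. B $ i $ k * C $ k $ j) = 0" for j
    using assms by (subst sum.swap) (simp add: zero_line_sums_def flip: sum_distrib_right)
  ultimately show ?thesis
    by (simp add: zero_line_sums_def matrix_matrix_mult_def)
qed

lemma zero_line_sums_add_scaled_outer:
  assumes "B \<in> zero_line_sums" "1 \<bullet> u = 0" "1 \<bullet> v = 0"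
  shows "B + c *\<^sub>R outer u v \<in> zero_line_sums"
  using assms
  by (simp add: zero_line_sums_def one_inner_eq_sum sum.distrib
      flip: sum_distrib_left sum_distrib_right)

lemma one_inner_zero_line_sums_mult:
  assumes "B \<in> zero_line_sums"
  shows "1 \<bullet> (B *v x) = 0"
proof -
  have "(\<Sum>i\<in>UNIV. \<Sum>k\<in>UNIV. B $ i $ k * x $ k) = 0"
    using assms by (subst sum.swap) (simp add: zero_line_sums_def flip: sum_distrib_right)
  then show ?thesis
    by (simp add: one_inner_eq_sum matrix_vector_mult_def)
qed

lemma canonical_form_mult:
  fixes P0 Q0 :: "real^'n^'n" and p q u v :: "real^'n" and s t :: real
  assumes P0: "P0 \<in> zero_line_sums" and Q0: "Q0 \<in> zero_line_sums"
    and z: "1 \<bullet> p = 0" "1 \<bullet> q = 0" "1 \<bullet> u = 0" "1 \<bullet> v = 0"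
  defines "y \<equiv> P0 *v u + (real CARD('n) * t) *\<^sub>R p"
    and "w \<equiv> transpose Q0 *v q + (real CARD('n) * s) *\<^sub>R v"
    and "M \<equiv> (outer p 1 + outer 1 q + P0 + s *\<^sub>R all_ones) **
              (outer u 1 + outer 1 v + Q0 + t *\<^sub>R all_ones)"
  shows "wt M = q \<bullet> u + real CARD('n) * s * t"
    and "canonical_decomp M (outer y 1 + outer 1 w) (P0 ** Q0 + real CARD('n) *\<^sub>R outer p v)"
proof -
  have sums: "(\<Sum>k\<in>UNIV. q $ k) = 0" "(\<Sum>k\<in>UNIV. u $ k) = 0"
    "\<And>i. (\<Sum>k\<in>UNIV. P0 $ i $ k) = 0" "\<And>j. (\<Sum>k\<in>UNIV. Q0 $ k $ j) = 0"
    using P0 Q0 z by (simp_all add: zero_line_sums_def one_inner_eq_sum)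
  have "M $ i $ j = y $ i + w $ j + ((P0 ** Q0) $ i $ j + real CARD('n) * (p $ i * v $ j))
      + (q \<bullet> u + real CARD('n) * s * t)" for i j
  proof -
    have "M $ i $ j = (\<Sum>k\<in>UNIV. (p $ i + q $ k + P0 $ i $ k + s) * (u $ k + v $ j + Q0 $ k $ j + t))"
      by (simp add: M_def matrix_matrix_mult_def)
    \<comment> \<open>The summands are grouped by their dependence on \<open>k\<close>: four genuine
      products, four terms with a factor free of \<open>k\<close> whose other factor sums to 0, and
      one term constant in \<open>k\<close>, which is counted n times.\<close>
    also have "\<dots> = (\<Sum>k\<in>UNIV. q $ k * u $ k + P0 $ i $ k * u $ k + Q0 $ k $ j * q $ k
        + P0 $ i $ k * Q0 $ k $ j + (p $ i + s) * u $ k + (v $ j + t) * q $ k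
        + (v $ j + t) * P0 $ i $ k + (p $ i + s) * Q0 $ k $ j + (p $ i + s) * (v $ j + t))"
      by (rule sum.cong) (simp_all add: algebra_simps)
    also have "\<dots> = q \<bullet> u + (P0 *v u) $ i + (transpose Q0 *v q) $ j + (P0 ** Q0) $ i $ j
        + real CARD('n) * ((p $ i + s) * (v $ j + t))"
      by (simp add: sum.distrib sums inner_vec_def matrix_vector_mult_def
          matrix_matrix_mult_def transpose_def flip: sum_distrib_left)
    finally show ?thesis
      by (simp add: y_def w_def algebra_simps)
  qed
  then have M: "M = (outer y 1 + outer 1 w) + (P0 ** Q0 + real CARD('n) *\<^sub>R outer p v)
      + (q \<bullet> u + real CARD('n) * s * t) *\<^sub>R all_ones"
    by (simp add: vec_eq_iff)
  have V: "outer y 1 + outer 1 w \<in> V_space"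
    using z P0 Q0
    \<comment> \<open>The simp rule \<open>transpose_matrix_vector\<close> would turn
      \<open>transpose Q0 *v q\<close> into \<open>q v* Q0\<close>, to which
      \<open>one_inner_zero_line_sums_mult\<close> does not apply.\<close>
    by (intro outer_sum_in_V_space)
      (simp_all add: y_def w_def inner_add_right one_inner_zero_line_sums_mult
        zero_line_sums_transpose del: transpose_matrix_vector)
  have Z: "P0 ** Q0 + real CARD('n) *\<^sub>R outer p v \<in> zero_line_sums"
    by (intro zero_line_sums_add_scaled_outer zero_line_sums_mult P0 Q0 z)
  show "wt M = q \<bullet> u + real CARD('n) * s * t"
    "canonical_decomp M (outer y 1 + outer 1 w) (P0 ** Q0 + real CARD('n) *\<^sub>R outer p v)"
    by (rule canonical_decompI[OF V Z M])+
qed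

theorem theorem3p1:
  fixes M MV M0 N NV N0 :: "real^'n^'n" and a b :: "real^'n"
  assumes M: "canonical_decomp M MV M0"
    and N: "canonical_decomp N NV N0"
    and NV: "NV = outer a 1 + outer 1 b"
    and a: "1 \<bullet> a = 0" and b: "1 \<bullet> b = 0"
  shows
    "(M = transpose N ** N \<longrightarrow>
        wt M = (norm a)\<^sup>2 + real CARD('n) * (wt N)\<^sup>2
      \<and> (let y = transpose N0 *v a + (real CARD('n) * wt N) *\<^sub>R b
         in MV = outer y 1 + outer 1 y)
      \<and> M0 = transpose N0 ** N0 + real CARD('n) *\<^sub>R outer b b)
     \<and>
     (M = N ** N \<longrightarrow>
        wt M = b \<bullet> a + real CARD('n) * (wt N)\<^sup>2
      \<and> (let y = N0 *v a + (real CARD('n) * wt N) *\<^sub>R a;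
             z = transpose N0 *v b + (real CARD('n) * wt N) *\<^sub>R b
         in MV = outer y 1 + outer 1 z)
      \<and> M0 = N0 ** N0 + real CARD('n) *\<^sub>R outer a b)"
proof -
  have N0: "N0 \<in> zero_line_sums" and N_eq: "N = outer a 1 + outer 1 b + N0 + wt N *\<^sub>R all_ones"
    using N by (auto simp: canonical_decomp_def NV)
  \<comment> \<open>\<open>N_eq\<close> has \<open>N\<close> on both sides, through
    \<open>wt N\<close>, so it is substituted just once.\<close>
  have entry: "N $ i $ j = a $ i + b $ j + N0 $ i $ j + wt N" for i j
    by (subst N_eq) simp
  have NT_eq: "transpose N = outer b 1 + outer 1 a + transpose N0 + wt N *\<^sub>R all_ones"
    by (simp add: vec_eq_iff transpose_def entry)
  \<comment> \<open>Transposing swaps \<open>a\<close> and \<open>b\<close>, so p = v = b and q = u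
    = a. Then \<open>y\<close> and \<open>w\<close> coincide, and the inner product of
    \<open>q\<close> and \<open>u\<close> is that of \<open>a\<close> with itself.\<close>
  note gram = canonical_form_mult[OF zero_line_sums_transpose[OF N0] N0 b a a b,
      of "wt N" "wt N", folded NT_eq N_eq]
  \<comment> \<open>Here p = u = a and q = v = b.\<close>
  note square = canonical_form_mult[OF N0 N0 a b a b, of "wt N" "wt N", folded N_eq]
  show ?thesis
  proof (intro conjI impI)
    assume [simp]: "M = transpose N ** N"
    note unique = canonical_decomp_unique[OF M gram(2)[folded \<open>M = _\<close>]]
    show "wt M = (norm a)\<^sup>2 + real CARD('n) * (wt N)\<^sup>2"
      using gram(1) by (simp add: dot_square_norm power2_eq_square)
    show "let y = transpose N0 *v a + (real CARD('n) * wt N) *\<^sub>R b in MV = outer y 1 + outer 1 y"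
      "M0 = transpose N0 ** N0 + real CARD('n) *\<^sub>R outer b b"
      using unique by (simp_all add: Let_def)
  next
    assume [simp]: "M = N ** N"
    note unique = canonical_decomp_unique[OF M square(2)[folded \<open>M = _\<close>]]
    show "wt M = b \<bullet> a + real CARD('n) * (wt N)\<^sup>2"
      using square(1) by (simp add: power2_eq_square)
    show "let y = N0 *v a + (real CARD('n) * wt N) *\<^sub>R a;
             z = transpose N0 *v b + (real CARD('n) * wt N) *\<^sub>R b
         in MV = outer y 1 + outer 1 z"
      "M0 = N0 ** N0 + real CARD('n) *\<^sub>R outer a b"
      using unique by (simp_all add: Let_def)
  qed
qed

end
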